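(* Let $(\varepsilon_k)_{k\ge 0}$ be a sequence of i.i.d. standard (real) Gaussian random variables. For every $\alpha \in (0,1)$ there exists a monotone bounded sequence $(c_k)_{k \ge 0}$ of real numbers (depending on $\alpha$ but not on $n$) such that, if $R_n$ denotes the number of real roots of the random polynomial $f_n(z) = \sum_{k=0}^n c_k \varepsilon_k z^k$, then $\mathbb{E} R_n = n^{\alpha + o(1)}$ as $n \to \infty$.
   Context: $o(1)$ denotes a quantity tending to zero as $n \to \infty$. *)

theory Defs
  imports "HOL-Probability.Probability" "HOL-Computational_Algebra.Polynomial"
begin

definition random_poly :: "(nat \<Rightarrow> real) \<Rightarrow> (nat \<Rightarrow> 'a \<Rightarrow> real) \<Rightarrow> nat \<Rightarrow> 'a \<Rightarrow> real poly" where
  "random_poly c \<epsilon> n \<omega> = (\<Sum>k\<le>n. monom (c k * \<epsilon> k \<omega>) k)"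

text \<open>Roots are counted without multiplicity. The value for the zero polynomial is the junk
  value \<open>0\<close>; as soon as some \<open>c k\<close> with \<open>k \<le> n\<close> is nonzero, this concerns a null event only.\<close>
definition num_real_roots :: "real poly \<Rightarrow> nat" where
  "num_real_roots p = card {x. poly p x = 0}"

text \<open>The expectation is a Bochner integral, which is \<open>0\<close> for a non-integrable function. Since
  \<open>n powr a > 0\<close> for \<open>n > 0\<close>, an equation \<open>integral\<^sup>L M X = n powr a\<close> thus entails that \<open>X\<close> is
  integrable.\<close>

definition power_asymp :: "(nat \<Rightarrow> real) \<Rightarrow> real \<Rightarrow> bool" where
  "power_asymp a \<alpha> \<longleftrightarrow>
     (\<exists>\<delta>. \<delta> \<longlonglongrightarrow> 0 \<and> (\<forall>\<^sub>F n in sequentially. a n = real n powr (\<alpha> + \<delta> n)))"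

end

(* Let c be constant on the blocks [m j, m (j+1)) with m j = ceil (j powr (1/alpha)), and let its
   values drop extremely fast from one block to the next. If n lies in a new block, then
   f_n = g + C h, where g is the polynomial of all earlier blocks and C is tiny. As C tends to 0 from
   above, the real roots of f_n are one root near each real root of g (these are simple almost
   surely), and at most one more far out on either half-line; a far root certainly appears if the
   leading coefficients of g and h are positive and negative, respectively, an event of positive
   probability not depending on n. By dominated convergence, C can be chosen so small that each block
   adds between a fixed positive constant and 3 to the expected number of roots, which is therefore
   of the order of the number of blocks, n powr alpha. *)
theory Submission
  imports Defs "HOL-Real_Asymp.Real_Asymp"
begin

text \<open>The obstacle is that the degree drops at C = 0: the deg h - deg g roots missing from g
  come in from infinity, and inside a long block there may be arbitrarily many of them. At most two
  of them are real because, near infinity, g looks like a x^d and C h like C b x^n, and two such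
  terms can balance only once on a half-line. How small C must be depends on the sample point, so
  the pointwise statement is not uniform. Passing to expectations is possible because root counts
  are bounded by the degree; it gives no rate, and none is needed, as the c_k may decrease
  arbitrarily fast. One C has to serve every n of the block, which works because a block is finite.
  The block containing n has index j = floor (n powr alpha), and alpha < 1 makes every block
  nonempty. Constant factors between j and the expected number of roots vanish in the exponent,
  since ln K / ln n tends to 0.\<close>

section \<open>Real roots of g + C h for small C\<close>

text \<open>The bound \<open>degree p \<le> n\<close> instead of equality lets one lemma cover two
  cases: a nonzero limit when n is the degree, and limit 0 when the coefficient at n cancels, as
  happens for \<open>G\<close> below.\<close>

lemma poly_div_power_tendsto:
  fixes p :: "real poly"
  assumes "degree p \<le> n"
  shows "((\<lambda>x. poly p x / x ^ n) \<longlongrightarrow> coeff p n) at_top"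
proof -
  have *: "((\<lambda>x::real. x ^ i / x ^ n) \<longlongrightarrow> (if i = n then 1 else 0)) at_top" if "i \<le> n" for i
  proof (cases "i = n")
    case True
    have "\<forall>\<^sub>F x::real in at_top. x ^ i / x ^ n = 1"
      using eventually_gt_at_top[of 0] by eventually_elim (use True in auto)
    then show ?thesis using True by (simp add: tendsto_eventually)
  next
    case False
    have "((\<lambda>x::real. inverse (x ^ (n - i))) \<longlongrightarrow> 0) at_top"
      by (intro tendsto_inverse_0_at_top filterlim_pow_at_top filterlim_ident) (use False that in auto)
    moreover have "\<forall>\<^sub>F x::real in at_top. inverse (x ^ (n - i)) = x ^ i / x ^ n"
      using eventually_gt_at_top[of 0]
      by eventually_elim (use that in \<open>simp add: power_diff divide_simps\<close>)
    ultimately show ?thesis using False by (auto intro: Lim_transform_eventually)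
  qed
  have "((\<lambda>x. \<Sum>i\<le>n. coeff p i * (x ^ i / x ^ n)) \<longlongrightarrow> (\<Sum>i\<le>n. coeff p i * (if i = n then 1 else 0))) at_top"
    by (intro tendsto_sum tendsto_mult tendsto_const *) auto
  moreover have "poly p x = (\<Sum>i\<le>n. coeff p i * x ^ i)" for x
    unfolding poly_altdef by (rule sum.mono_neutral_left) (use assms in \<open>auto simp: coeff_eq_0\<close>)
  then have "(\<lambda>x. \<Sum>i\<le>n. coeff p i * (x ^ i / x ^ n)) = (\<lambda>x. poly p x / x ^ n)"
    by (auto simp: sum_divide_distrib)
  moreover have "(\<Sum>i\<le>n. coeff p i * (if i = n then 1 else 0)) = coeff p n"
    by (simp add: if_distrib cong: if_cong)
  ultimately show ?thesis by simp
qed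

lemma card_le_1I:
  assumes "\<And>x y. x \<in> A \<Longrightarrow> y \<in> A \<Longrightarrow> x = y"
  shows "card A \<le> 1"
proof (cases "A = {}")
  case False
  then obtain a where "a \<in> A" by auto
  then have "A = {a}" using assms by auto
  then show ?thesis by simp
qed simp

text \<open>Two large roots u < v give a critical point w > u of f / x^d by Rolle. The root equation bounds
  C u^(n-d) from below and the equation for w bounds C w^(n-d) from above, so C cancels and the
  threshold B does not depend on it.\<close>

lemma perturbed_poly_at_most_one_large_root:
  fixes g h :: "real poly"
  assumes "g \<noteq> 0" "degree g < degree h"
  obtains B where "B > 0"
    "\<And>C u v. C > 0 \<Longrightarrow> B \<le> u \<Longrightarrow> B \<le> v \<Longrightarrow>
      poly (g + smult C h) u = 0 \<Longrightarrow> poly (g + smult C h) v = 0 \<Longrightarrow> u = v"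
proof -
  define d n where "d = degree g" and "n = degree h"
  define a b where "a = lead_coeff g" and "b = lead_coeff h"
  \<comment> \<open>\<open>G\<close> is x g' - d g, the numerator of the derivative of g / x^d, and
    \<open>H\<close> is the same expression for h. A critical point w of f / x^d thus satisfies G(w)
    + C H(w) = 0. The coefficient of \<open>G\<close> at d cancels, so G is o(x^d), whereas
    \<open>H\<close> keeps the nonzero coefficient (n - d) b at n.\<close>
  define G where "G = pCons 0 (pderiv g) - smult (of_nat d) g"
  define H where "H = pCons 0 (pderiv h) - smult (of_nat d) h"
  have dn: "d < n" and a0: "a \<noteq> 0" and b0: "b \<noteq> 0"
    using assms by (auto simp: d_def n_def a_def b_def)
  have cG: "coeff G i = (of_nat i - of_nat d) * coeff g i" for i
    unfolding G_def by (cases i) (auto simp: coeff_pderiv algebra_simps)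
  have cH: "coeff H i = (of_nat i - of_nat d) * coeff h i" for i
    unfolding H_def by (cases i) (auto simp: coeff_pderiv algebra_simps)
  have degG: "degree G \<le> d"
    by (intro degree_le) (auto simp: cG d_def coeff_eq_0)
  have degH: "degree H \<le> n"
    by (intro degree_le) (auto simp: cH n_def coeff_eq_0)
  \<comment> \<open>The final chain gives |a| / 2 < 4 A, the factor 4 being the ratio of the bounds
    2 |b| and |b| / 2. With A = |a| / 16 the right side is |a| / 4, a contradiction.\<close>
  define A where "A = \<bar>a\<bar> / 16"
  have A0: "A > 0" using a0 by (simp add: A_def)
  have lg: "((\<lambda>x. poly g x / x ^ d) \<longlongrightarrow> a) at_top"
    using poly_div_power_tendsto[of g d] by (simp add: d_def a_def)
  have lh: "((\<lambda>x. poly h x / x ^ n) \<longlongrightarrow> b) at_top"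
    using poly_div_power_tendsto[of h n] by (simp add: n_def b_def)
  have lG: "((\<lambda>x. poly G x / x ^ d) \<longlongrightarrow> 0) at_top"
    using poly_div_power_tendsto[OF degG] by (simp add: cG)
  have lH: "((\<lambda>x. poly H x / x ^ n) \<longlongrightarrow> (n - d) * b) at_top"
    using poly_div_power_tendsto[OF degH] dn by (simp add: cH b_def n_def of_nat_diff)
  have bn: "\<bar>b\<bar> / 2 < \<bar>(n - d) * b\<bar>"
  proof -
    have "1 * \<bar>b\<bar> \<le> real (n - d) * \<bar>b\<bar>" using dn by (intro mult_right_mono) auto
    then show ?thesis using b0 by (simp add: abs_mult)
  qed
  have "\<forall>\<^sub>F x in at_top. x > 0 \<and> \<bar>a\<bar> / 2 < \<bar>poly g x / x ^ d\<bar> \<and> \<bar>poly h x / x ^ n\<bar> < 2 * \<bar>b\<bar> \<and>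
          \<bar>poly G x / x ^ d\<bar> < A \<and> \<bar>b\<bar> / 2 < \<bar>poly H x / x ^ n\<bar>"
    using order_tendstoD(1)[OF tendsto_rabs[OF lg], of "\<bar>a\<bar> / 2"] a0
      order_tendstoD(2)[OF tendsto_rabs[OF lh], of "2 * \<bar>b\<bar>"] b0
      order_tendstoD(2)[OF tendsto_rabs[OF lG], of A] A0
      order_tendstoD(1)[OF tendsto_rabs[OF lH] bn]
    by (intro eventually_conj eventually_gt_at_top) auto
  then obtain B0 where B0: "\<And>x. x \<ge> B0 \<Longrightarrow> x > 0 \<and> \<bar>a\<bar> / 2 < \<bar>poly g x / x ^ d\<bar> \<and> \<bar>poly h x / x ^ n\<bar> < 2 * \<bar>b\<bar> \<and>
          \<bar>poly G x / x ^ d\<bar> < A \<and> \<bar>b\<bar> / 2 < \<bar>poly H x / x ^ n\<bar>"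
    by (auto simp: eventually_at_top_linorder)
  have no: False if C: "C > 0" and u: "B0 \<le> u" "u < v"
    and fu: "poly (g + smult C h) u = 0" and fv: "poly (g + smult C h) v = 0" for C u v
  proof -
    define f where "f = g + smult C h"
    have u0: "u > 0" using B0 u by auto
    have der: "((\<lambda>x. poly f x / x ^ d) has_real_derivative
            (x * poly (pderiv f) x - d * poly f x) / (x * x ^ d)) (at x)" if "x > 0" for x
    proof -
      have "((\<lambda>x. poly f x / x ^ d) has_real_derivative
              (poly (pderiv f) x * x ^ d - poly f x * (d * x ^ (d - Suc 0))) / (x ^ d * x ^ d)) (at x)"
        using that by (auto intro!: derivative_eq_intros)
      also have "(poly (pderiv f) x * x ^ d - poly f x * (d * x ^ (d - Suc 0))) / (x ^ d * x ^ d) =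
                 (x * poly (pderiv f) x - d * poly f x) / (x * x ^ d)"
        using that by (cases d) (auto simp: divide_simps, simp add: algebra_simps)
      finally show ?thesis .
    qed
    obtain w where w: "u < w" "w < v" and "((w * poly (pderiv f) w - d * poly f w) / (w * w ^ d)) = 0"
    proof -
      have "\<exists>w. u < w \<and> w < v \<and> (*) ((w * poly (pderiv f) w - d * poly f w) / (w * w ^ d)) = (\<lambda>_. 0)"
      proof (rule Rolle_deriv[OF \<open>u < v\<close>])
        show "poly f u / u ^ d = poly f v / v ^ d" using fu fv by (simp add: f_def)
        show "continuous_on {u..v} (\<lambda>x. poly f x / x ^ d)"
          using u0 by (intro continuous_intros) auto
        show "((\<lambda>x. poly f x / x ^ d) has_derivative (*) ((x * poly (pderiv f) x - d * poly f x) / (x * x ^ d))) (at x)"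
          if "u < x" for x
          using der[of x] u0 that by (simp add: has_field_derivative_def)
      qed
      then show ?thesis using that by (auto dest!: fun_cong[of _ _ 1])
    qed
    then have "w * poly (pderiv f) w - d * poly f w = 0" using u0 by auto
    then have GH: "poly G w + C * poly H w = 0"
      by (simp add: f_def G_def H_def pderiv_add pderiv_smult algebra_simps)
    have pow: "x ^ n = x ^ (n - d) * x ^ d" for x :: real
      using dn by (simp flip: power_add)
    have gh: "poly g u + C * poly h u = 0" using fu by simp
    have "\<bar>a\<bar> / 2 < \<bar>poly g u / u ^ d\<bar>" using B0 u by auto
    also have "poly g u / u ^ d = - (C * u ^ (n - d)) * (poly h u / u ^ n)"
      using pow[of u] gh u0 by (simp add: field_simps eq_neg_iff_add_eq_0)
    also have "\<bar>\<dots>\<bar> = C * u ^ (n - d) * \<bar>poly h u / u ^ n\<bar>"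
      using C u0 by (simp add: abs_mult)
    also have "\<dots> \<le> C * w ^ (n - d) * (2 * \<bar>b\<bar>)"
      using C u0 w B0[of u] u by (intro mult_mono power_mono) (auto intro: less_imp_le)
    also have "\<dots> = 4 * (C * w ^ (n - d) * (\<bar>b\<bar> / 2))" by simp
    also have "\<dots> \<le> 4 * (C * w ^ (n - d) * \<bar>poly H w / w ^ n\<bar>)"
      using C u0 w B0[of w] u by (intro mult_mono order_refl) (auto intro: less_imp_le)
    also have "C * w ^ (n - d) * \<bar>poly H w / w ^ n\<bar> = \<bar>C * w ^ (n - d) * (poly H w / w ^ n)\<bar>"
      using C u0 w by (simp add: abs_mult)
    also have "C * w ^ (n - d) * (poly H w / w ^ n) = - (poly G w / w ^ d)"
      using pow[of w] GH u0 w by (simp add: field_simps eq_neg_iff_add_eq_0)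
    also have "4 * \<bar>- (poly G w / w ^ d)\<bar> < 4 * A"
      using B0[of w] u w by auto
    finally show False by (simp add: A_def)
  qed
  show ?thesis
  proof (rule that[of "max 1 B0"])
    fix C u v assume "C > 0" "max 1 B0 \<le> u" "max 1 B0 \<le> v"
      "poly (g + smult C h) u = 0" "poly (g + smult C h) v = 0"
    then show "u = v" using no[of C u v] no[of C v u] by (cases u v rule: linorder_cases) auto
  qed auto
qed

text \<open>The reflection x to -x preserves degrees and the form g + C h with the same C > 0, and
  exchanges the two half-lines.\<close>

lemma perturbed_poly_at_most_one_large_negative_root:
  fixes g h :: "real poly"
  assumes "g \<noteq> 0" "degree g < degree h"
  obtains B where "B > 0"
    "\<And>C u v. C > 0 \<Longrightarrow> u \<le> - B \<Longrightarrow> v \<le> - B \<Longrightarrow>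
      poly (g + smult C h) u = 0 \<Longrightarrow> poly (g + smult C h) v = 0 \<Longrightarrow> u = v"
proof -
  let ?r = "\<lambda>p. pcompose p [:0, -1::real:]"
  have "?r g \<noteq> 0" "degree (?r g) < degree (?r h)"
    using assms by (auto simp: pcompose_eq_0_iff degree_pcompose)
  from perturbed_poly_at_most_one_large_root[OF this] obtain B where B: "B > 0"
    "\<And>C u v. C > 0 \<Longrightarrow> B \<le> u \<Longrightarrow> B \<le> v \<Longrightarrow>
      poly (?r g + smult C (?r h)) u = 0 \<Longrightarrow> poly (?r g + smult C (?r h)) v = 0 \<Longrightarrow> u = v"
    by blast
  show ?thesis
  proof (rule that[OF B(1)])
    fix C u v assume "C > 0" "u \<le> - B" "v \<le> - B"
      "poly (g + smult C h) u = 0" "poly (g + smult C h) v = 0"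
    then show "u = v" using B(2)[of C "-u" "-v"] by (auto simp: poly_pcompose)
  qed
qed

section \<open>Upper bound for the number of roots\<close>

text \<open>On a compact set |g| has a positive minimum and |h| is bounded, so C |h| is eventually
  too small to cancel g. This is applied to g away from its roots, and to the derivatives close to
  them.\<close>

lemma eventually_perturbed_poly_nonzero:
  fixes g h :: "real poly"
  assumes "compact S" "\<And>x. x \<in> S \<Longrightarrow> poly g x \<noteq> 0"
  shows "\<forall>\<^sub>F C in at_right 0. \<forall>x\<in>S. poly (g + smult C h) x \<noteq> 0"
proof (cases "S = {}")
  case False
  have cont: "continuous_on S (\<lambda>x. \<bar>poly p x\<bar>)" for p :: "real poly"
    by (intro continuous_intros)
  obtain x0 where x0: "x0 \<in> S" "\<And>x. x \<in> S \<Longrightarrow> \<bar>poly g x0\<bar> \<le> \<bar>poly g x\<bar>"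
    using continuous_attains_inf[OF assms(1) False, of "\<lambda>x. \<bar>poly g x\<bar>"]
    cont by blast
  obtain x1 where x1: "\<And>x. x \<in> S \<Longrightarrow> \<bar>poly h x\<bar> \<le> \<bar>poly h x1\<bar>"
    using continuous_attains_sup[OF assms(1) False, of "\<lambda>x. \<bar>poly h x\<bar>"]
    cont by blast
  have "((\<lambda>C. C * \<bar>poly h x1\<bar>) \<longlongrightarrow> 0 * \<bar>poly h x1\<bar>) (at_right 0)"
    by (intro tendsto_intros)
  then have "\<forall>\<^sub>F C in at_right 0. C * \<bar>poly h x1\<bar> < \<bar>poly g x0\<bar>"
    by (rule order_tendstoD(2)) (use assms(2) x0 in auto)
  then show ?thesis
    using eventually_at_right_less
  proof eventually_elim
    case (elim C)
    show ?case
    proof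
      fix x assume x: "x \<in> S"
      have "\<bar>C * poly h x\<bar> \<le> C * \<bar>poly h x1\<bar>" using elim x1[OF x] by (simp add: abs_mult)
      also have "\<dots> < \<bar>poly g x\<bar>" using elim x0(2)[OF x] by linarith
      finally show "poly (g + smult C h) x \<noteq> 0" by auto
    qed
  qed
qed auto

text \<open>The line is covered by two far half-lines with at most one root each, small balls around
  the roots of g, and a compact rest without roots. In a ball the derivative of g + C h does not
  vanish, so Rolle leaves room for one root only.\<close>

lemma eventually_num_real_roots_perturbed_le:
  fixes g h :: "real poly"
  assumes "g \<noteq> 0" "degree g < degree h"
    and simple: "\<And>x. poly g x = 0 \<Longrightarrow> poly (pderiv g) x \<noteq> 0"
  shows "\<forall>\<^sub>F C in at_right 0. num_real_roots (g + smult C h) \<le> num_real_roots g + 2"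
proof -
  obtain B1 where B1: "B1 > 0" "\<And>C u v. C > 0 \<Longrightarrow> B1 \<le> u \<Longrightarrow> B1 \<le> v \<Longrightarrow>
      poly (g + smult C h) u = 0 \<Longrightarrow> poly (g + smult C h) v = 0 \<Longrightarrow> u = v"
    using perturbed_poly_at_most_one_large_root[OF assms(1,2)] by blast
  obtain B2 where B2: "B2 > 0" "\<And>C u v. C > 0 \<Longrightarrow> u \<le> - B2 \<Longrightarrow> v \<le> - B2 \<Longrightarrow>
      poly (g + smult C h) u = 0 \<Longrightarrow> poly (g + smult C h) v = 0 \<Longrightarrow> u = v"
    using perturbed_poly_at_most_one_large_negative_root[OF assms(1,2)] by blast
  define Z where "Z = {x. poly g x = 0}"
  have finZ: "finite Z" using assms(1) by (simp add: Z_def poly_roots_finite)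
  have "\<exists>e>0. \<forall>x\<in>cball z e. poly (pderiv g) x \<noteq> 0" if "z \<in> Z" for z
  proof -
    have "open {x. poly (pderiv g) x \<noteq> 0}"
      by (intro open_Collect_neq continuous_intros)
    moreover have "z \<in> {x. poly (pderiv g) x \<noteq> 0}" using simple that by (auto simp: Z_def)
    ultimately show ?thesis unfolding open_contains_cball by blast
  qed
  then obtain e where e: "\<And>z. z \<in> Z \<Longrightarrow> e z > 0" "\<And>z x. z \<in> Z \<Longrightarrow> x \<in> cball z (e z) \<Longrightarrow> poly (pderiv g) x \<noteq> 0"
    by metis
  \<comment> \<open>Closed balls here, because the nonvanishing lemma asks for compact sets. The
    next fact removes open balls, so that the rest of the interval is compact too.\<close>
  have 1: "\<forall>\<^sub>F C in at_right 0. \<forall>z\<in>Z. \<forall>x\<in>cball z (e z). poly (pderiv g + smult C (pderiv h)) x \<noteq> 0"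
    by (intro eventually_ball_finite finZ ballI eventually_perturbed_poly_nonzero e(2)) auto
  have 2: "\<forall>\<^sub>F C in at_right 0. \<forall>x\<in>{-B2..B1} - (\<Union>z\<in>Z. ball z (e z)). poly (g + smult C h) x \<noteq> 0"
    by (intro eventually_perturbed_poly_nonzero compact_diff) (use e(1) in \<open>force simp: Z_def\<close>)+
  show ?thesis using 1 2 eventually_at_right_less
  proof eventually_elim
    case (elim C)
    define f where "f = g + smult C h"
    let ?R = "{x. poly f x = 0}"
    have "coeff f (degree h) \<noteq> 0"
      using assms(2) elim by (auto simp: f_def coeff_eq_0)
    then have f0: "f \<noteq> 0" by auto
    have finR: "finite ?R" using f0 by (simp add: poly_roots_finite)
    have c1: "card (?R \<inter> {B1..}) \<le> 1" 
      by (rule card_le_1I) (use B1(2) elim in \<open>auto simp: f_def\<close>)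
    have c2: "card (?R \<inter> {..-B2}) \<le> 1"
      by (rule card_le_1I) (use B2(2) elim in \<open>auto simp: f_def\<close>)
    have c3: "card (?R \<inter> ball z (e z)) \<le> 1" if z: "z \<in> Z" for z
    proof (rule card_le_1I)
      have no: False if uv: "u < v" "poly f u = 0" "poly f v = 0" "u \<in> ball z (e z)" "v \<in> ball z (e z)" for u v
      proof -
        obtain w where "u < w" "w < v" "poly (pderiv f) w = 0"
          using poly_MVT[of u v f] uv by auto
        moreover have "w \<in> cball z (e z)"
          using uv calculation by (auto simp: dist_real_def)
        ultimately show False
          using elim(1) z by (auto simp: f_def pderiv_add pderiv_smult)
      qed
      show "u = v" if "u \<in> ?R \<inter> ball z (e z)" "v \<in> ?R \<inter> ball z (e z)" for u v
        using no[of u v] no[of v u] that by (cases u v rule: linorder_cases) auto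
    qed
    have "?R \<subseteq> (?R \<inter> {B1..}) \<union> (?R \<inter> {..-B2}) \<union> (\<Union>z\<in>Z. ?R \<inter> ball z (e z))"
      using elim(2) by (auto simp: f_def)
    then have "card ?R \<le> card ((?R \<inter> {B1..}) \<union> (?R \<inter> {..-B2}) \<union> (\<Union>z\<in>Z. ?R \<inter> ball z (e z)))"
      by (intro card_mono) (use finR finZ in auto)
    also have "\<dots> \<le> card (?R \<inter> {B1..}) + card (?R \<inter> {..-B2}) + card (\<Union>z\<in>Z. ?R \<inter> ball z (e z))"
      by (meson add_le_mono card_Un_le order_trans order_refl)
    also have "card (\<Union>z\<in>Z. ?R \<inter> ball z (e z)) \<le> (\<Sum>z\<in>Z. card (?R \<inter> ball z (e z)))"
      by (rule card_UN_le[OF finZ])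
    also have "\<dots> \<le> (\<Sum>z\<in>Z. 1)" by (intro sum_mono c3)
    finally show ?case using c1 c2 by (simp add: num_real_roots_def Z_def f_def)
  qed
qed


section \<open>Lower bound for the number of roots\<close>

text \<open>At a simple root g changes sign. The signs at two fixed points z - t and z + t survive a
  small perturbation, and the intermediate value theorem applies. A negative derivative is reduced
  to a positive one by negating both g and h.\<close>

lemma eventually_perturbed_poly_root_near_simple_root:
  fixes g h :: "real poly"
  assumes "poly g z = 0" "poly (pderiv g) z \<noteq> 0" "e > 0"
  shows "\<forall>\<^sub>F C in at_right 0. \<exists>x. \<bar>x - z\<bar> < e \<and> poly (g + smult C h) x = 0"
proof -
  have *: "\<forall>\<^sub>F C in at_right 0. \<exists>x. \<bar>x - z\<bar> < e \<and> poly (g + smult C h) x = 0"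
    if g: "poly g z = 0" "poly (pderiv g) z > 0" for g h :: "real poly"
  proof -
    have lim: "((\<lambda>C. poly (g + smult C h) x) \<longlongrightarrow> poly g x + 0 * poly h x) (at_right 0)" for x
      unfolding poly_add poly_smult by (intro tendsto_intros)
    obtain d1 where d1: "d1 > 0" "\<And>t. 0 < t \<Longrightarrow> t < d1 \<Longrightarrow> 0 < poly g (z + t)"
      using DERIV_pos_inc_right[OF poly_DERIV g(2)] g(1) by auto
    obtain d2 where d2: "d2 > 0" "\<And>t. 0 < t \<Longrightarrow> t < d2 \<Longrightarrow> poly g (z - t) < 0"
      using DERIV_pos_inc_left[OF poly_DERIV g(2)] g(1) by auto
    define t where "t = Min {d1, d2, e} / 2"
    have t: "0 < t" "t < d1" "t < d2" "t < e"
      using d1 d2 assms(3) by (auto simp: t_def)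
    have "\<forall>\<^sub>F C in at_right 0. poly (g + smult C h) (z + t) > 0"
      by (rule order_tendstoD(1)[OF lim]) (use d1 t in auto)
    moreover have "\<forall>\<^sub>F C in at_right 0. poly (g + smult C h) (z - t) < 0"
      by (rule order_tendstoD(2)[OF lim]) (use d2 t in auto)
    ultimately show ?thesis
    proof eventually_elim
      case (elim C)
      then obtain x where "z - t < x" "x < z + t" "poly (g + smult C h) x = 0"
        using poly_IVT_pos[of "z - t" "z + t" "g + smult C h"] t by auto
      with t show ?case by (intro exI[of _ x]) auto
    qed
  qed
  show ?thesis
  proof (cases "poly (pderiv g) z > 0")
    case False
    have "poly (- g + smult C (- h)) x = 0 \<longleftrightarrow> poly (g + smult C h) x = 0" for C x
      by auto
    with *[of "- g" "- h"] False assms show ?thesis by (simp add: pderiv_minus)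
  qed (use * assms in blast)
qed

text \<open>Disjoint neighbourhoods of the roots of g supply distinct roots. In the sign-change case
  g + C h is still positive at a point \<open>B\<close> to the right of all these neighbourhoods,
  but tends to minus infinity, so one more root lies beyond \<open>B\<close>.\<close>

lemma eventually_num_real_roots_perturbed_ge:
  fixes g h :: "real poly"
  assumes "g \<noteq> 0" "degree g < degree h"
    and simple: "\<And>x. poly g x = 0 \<Longrightarrow> poly (pderiv g) x \<noteq> 0"
  shows "\<forall>\<^sub>F C in at_right 0. num_real_roots g +
           (if lead_coeff g > 0 \<and> lead_coeff h < 0 then 1 else 0) \<le> num_real_roots (g + smult C h)"
proof -
  define Z where "Z = {x. poly g x = 0}"
  have finZ: "finite Z" using assms(1) by (simp add: Z_def poly_roots_finite)
  have lim: "((\<lambda>C. poly (g + smult C h) x) \<longlongrightarrow> poly g x + 0 * poly h x) (at_right 0)" for x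
    unfolding poly_add poly_smult by (intro tendsto_intros)
  obtain e where e: "e > 0" "\<And>y z. y \<in> Z \<Longrightarrow> z \<in> Z \<Longrightarrow> y \<noteq> z \<Longrightarrow> 2 * e \<le> \<bar>y - z\<bar>"
  proof -
    \<comment> \<open>\<open>D\<close> is empty if g has at most one root; inserting 1 keeps the
      minimum meaningful.\<close>
    define D where "D = (\<lambda>(y, z). \<bar>y - z\<bar>) ` {p \<in> Z \<times> Z. fst p \<noteq> snd p}"
    have fin: "finite D" unfolding D_def
      by (intro finite_imageI finite_subset[of "{p \<in> Z \<times> Z. fst p \<noteq> snd p}" "Z \<times> Z"]) (use finZ in auto)
    have pos: "Min (insert 1 D) > 0" using fin by (subst Min_gr_iff) (auto simp: D_def)
    have "Min (insert 1 D) \<le> \<bar>y - z\<bar>" if "y \<in> Z" "z \<in> Z" "y \<noteq> z" for y z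
      by (rule Min_le) (use fin that in \<open>auto simp: D_def intro!: image_eqI[of _ _ "(y, z)"]\<close>)
    with pos that[of "Min (insert 1 D) / 2"] show thesis by auto
  qed
  \<comment> \<open>\<open>B\<close> is fixed before C, so positivity at \<open>B\<close> passes
    from g to g + C h for small C.\<close>
  obtain B where B: "\<And>z. z \<in> Z \<Longrightarrow> z + e < B" "lead_coeff g > 0 \<Longrightarrow> poly g B > 0"
  proof -
    have "\<forall>\<^sub>F B in at_top. \<forall>z\<in>Z. z + e < B"
      by (intro eventually_ball_finite finZ ballI eventually_gt_at_top)
    moreover have "\<forall>\<^sub>F B in at_top. lead_coeff g > 0 \<longrightarrow> poly g B > 0"
      using poly_pinfty_gt_lc[of g] unfolding eventually_at_top_linorder by fastforce
    ultimately have "\<forall>\<^sub>F B in at_top. (\<forall>z\<in>Z. z + e < B) \<and> (lead_coeff g > 0 \<longrightarrow> poly g B > 0)"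
      by eventually_elim auto
    then show thesis using that by (auto simp: eventually_at_top_linorder)
  qed
  have 1: "\<forall>\<^sub>F C in at_right 0. \<forall>z\<in>Z. \<exists>x. \<bar>x - z\<bar> < e \<and> poly (g + smult C h) x = 0"
    by (intro eventually_ball_finite finZ ballI eventually_perturbed_poly_root_near_simple_root)
       (use e simple in \<open>auto simp: Z_def\<close>)
  have 2: "\<forall>\<^sub>F C in at_right 0. lead_coeff g > 0 \<longrightarrow> poly (g + smult C h) B > 0"
    using order_tendstoD(1)[OF lim[of B], of 0] B(2)
    by (cases "lead_coeff g > 0") auto
  show ?thesis using 1 2 eventually_at_right_less
  proof eventually_elim
    case (elim C)
    define f where "f = g + smult C h"
    let ?R = "{x. poly f x = 0}"
    have lc: "lead_coeff f = C * lead_coeff h" and f0: "f \<noteq> 0"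
    proof -
      have "degree f = degree h"
        unfolding f_def using assms(2) elim by (subst degree_add_eq_right) auto
      then show "lead_coeff f = C * lead_coeff h"
        using assms(2) by (simp add: f_def coeff_eq_0)
      with elim assms(2) show "f \<noteq> 0" by auto
    qed
    have finR: "finite ?R" using f0 by (simp add: poly_roots_finite)
    obtain r where r: "\<And>z. z \<in> Z \<Longrightarrow> \<bar>r z - z\<bar> < e \<and> poly f (r z) = 0"
      using elim(1) unfolding f_def by metis
    have inj: "inj_on r Z"
    proof (rule inj_onI)
      fix y z assume yz: "y \<in> Z" "z \<in> Z" "r y = r z"
      then have "\<bar>y - z\<bar> < 2 * e" using r[of y] r[of z] by auto
      then show "y = z" using e(2)[of y z] yz by force
    qed
    show ?case
    proof (cases "lead_coeff g > 0 \<and> lead_coeff h < 0")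
      case False
      have "card (r ` Z) \<le> card ?R" by (rule card_mono) (use finR r in auto)
      then show ?thesis unfolding if_not_P[OF False] using inj by (simp add: card_image num_real_roots_def Z_def f_def)
    next
      case True
      have "lead_coeff (- f) > 0" using lc True elim by (simp add: mult_pos_neg)
      then obtain v0 where "\<And>x. x \<ge> v0 \<Longrightarrow> poly (- f) x > 0"
        using poly_pinfty_gt_lc[of "- f"] by fastforce
      then have "poly f (max v0 (B + 1)) < 0" by (simp add: max_def split: if_splits)
      moreover have "B < max v0 (B + 1)" by simp
      moreover have "poly f B > 0" using elim True by (simp add: f_def)
      ultimately obtain x where x: "B < x" "poly f x = 0"
        using poly_IVT_neg[of B "max v0 (B + 1)" f] by blast
      have "x \<notin> r ` Z"
        using x B(1) r by force
      then have "Suc (card Z) = card (insert x (r ` Z))"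
        using inj finZ by (simp add: card_image)
      also have "\<dots> \<le> card ?R" by (rule card_mono) (use finR r x in auto)
      finally show ?thesis using True by (simp add: num_real_roots_def Z_def f_def)
    qed
  qed
qed


section \<open>Measurability of the number of real roots\<close>

text \<open>The uncountable quantifier over x becomes countable: by compactness a continuous
  function has a zero iff it takes arbitrarily small absolute values, and by continuity these can be
  sought at countably many points.\<close>

lemma measurable_pred_ex_root_Icc:
  fixes F :: "'a \<Rightarrow> real \<Rightarrow> real"
  assumes meas: "\<And>x. (\<lambda>\<omega>. F \<omega> x) \<in> borel_measurable M"
    and cont: "\<And>\<omega>. continuous_on UNIV (F \<omega>)"
  shows "Measurable.pred M (\<lambda>\<omega>. \<exists>x\<in>{a..b}. F \<omega> x = 0)"
proof (cases "a \<le> b")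
  case False
  then show ?thesis by simp
next
  case True
  \<comment> \<open>Rational parameters q in [0, 1] replace rational points of the interval, because
    for a = b irrational the interval contains no rational point.\<close>
  have "(\<exists>x\<in>{a..b}. F \<omega> x = 0) \<longleftrightarrow> (\<forall>n::nat. \<exists>q\<in>\<rat> \<inter> {0..1}. \<bar>F \<omega> (a + (b - a) * q)\<bar> < 1 / Suc n)"
    (is "?L \<longleftrightarrow> ?R") for \<omega>
  proof
    assume ?L
    then obtain x where x: "x \<in> {a..b}" "F \<omega> x = 0" by auto
    define t where "t = (if a = b then 0 else (x - a) / (b - a))"
    have t: "0 \<le> t" "t \<le> 1" "x = a + (b - a) * t"
      using x True by (auto simp: t_def)
    show ?R
    proof
      fix n :: nat
      have "continuous_on UNIV (\<lambda>q. \<bar>F \<omega> (a + (b - a) * q)\<bar>)"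
        by (intro continuous_intros continuous_on_compose2[OF cont[of \<omega>]]) auto
      then have "isCont (\<lambda>q. \<bar>F \<omega> (a + (b - a) * q)\<bar>) t"
        by (simp add: continuous_on_eq_continuous_at)
      then have "\<forall>\<^sub>F q in at t. \<bar>F \<omega> (a + (b - a) * q)\<bar> < 1 / Suc n"
        unfolding isCont_def by (rule order_tendstoD(2)) (use t(3) x(2) in auto)
      then obtain d where d: "d > 0" "\<And>q. q \<noteq> t \<Longrightarrow> dist q t < d \<Longrightarrow> \<bar>F \<omega> (a + (b - a) * q)\<bar> < 1 / Suc n"
        by (auto simp: eventually_at)
      obtain q where q: "q \<in> \<rat>" "max 0 (t - d) < q" "q < min 1 (t + d)"
        using Rats_dense_in_real[of "max 0 (t - d)" "min 1 (t + d)"] t d by auto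
      have "\<bar>F \<omega> (a + (b - a) * q)\<bar> < 1 / Suc n"
      proof (cases "q = t")
        case True
        then show ?thesis using t(3) x(2) by simp
      next
        case False
        then show ?thesis using d(2)[of q] q by (auto simp: dist_real_def)
      qed
      then show "\<exists>q\<in>\<rat> \<inter> {0..1}. \<bar>F \<omega> (a + (b - a) * q)\<bar> < 1 / Suc n"
        using q by (intro bexI[of _ q]) auto
    qed
  next
    assume R: ?R
    have "continuous_on {a..b} (\<lambda>x. \<bar>F \<omega> x\<bar>)"
      by (intro continuous_intros continuous_on_subset[OF cont[of \<omega>]]) auto
    then obtain x0 where x0: "x0 \<in> {a..b}" "\<And>x. x \<in> {a..b} \<Longrightarrow> \<bar>F \<omega> x0\<bar> \<le> \<bar>F \<omega> x\<bar>"
      using continuous_attains_inf[of "{a..b}" "\<lambda>x. \<bar>F \<omega> x\<bar>"] True by auto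
    have "\<bar>F \<omega> x0\<bar> < 1 / Suc n" for n :: nat
    proof -
      obtain q where q: "q \<in> {0..1}" "\<bar>F \<omega> (a + (b - a) * q)\<bar> < 1 / Suc n" using R by blast
      have "(b - a) * q \<le> (b - a) * 1" using q True by (intro mult_left_mono) auto
      then have "a + (b - a) * q \<in> {a..b}" using q True by auto
      from x0(2)[OF this] q show ?thesis by linarith
    qed
    then have "\<not> 0 < \<bar>F \<omega> x0\<bar>"
      using nat_approx_posE[of "\<bar>F \<omega> x0\<bar>"] by (metis not_less_iff_gr_or_eq order_less_trans)
    with x0 show ?L by auto
  qed
  moreover have "Measurable.pred M (\<lambda>\<omega>. \<forall>n::nat. \<exists>q\<in>\<rat> \<inter> {0..1}. \<bar>F \<omega> (a + (b - a) * q)\<bar> < 1 / Suc n)"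
  proof -
    have "countable (\<rat> \<inter> {0..1::real})" using countable_rat by auto
    then show ?thesis using meas
      by (intro pred_intros_countable pred_intros_countable_bounded) measurable
  qed
  ultimately show ?thesis by simp
qed

lemma measurable_pred_ex_root_Ico:
  fixes F :: "'a \<Rightarrow> real \<Rightarrow> real"
  assumes "\<And>x. (\<lambda>\<omega>. F \<omega> x) \<in> borel_measurable M" "\<And>\<omega>. continuous_on UNIV (F \<omega>)"
  shows "Measurable.pred M (\<lambda>\<omega>. \<exists>x\<in>{a..<b}. F \<omega> x = 0)"
proof -
  have "x \<in> {a..<b} \<longleftrightarrow> (\<exists>n::nat. x \<in> {a..b - 1 / Suc n})" for x
  proof
    assume "x \<in> {a..<b}"
    moreover then obtain n where "1 / Suc n < b - x" using nat_approx_posE[of "b - x"] by auto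
    ultimately show "\<exists>n::nat. x \<in> {a..b - 1 / Suc n}" by (intro exI[of _ n]) auto
  next
    assume "\<exists>n::nat. x \<in> {a..b - 1 / Suc n}"
    then obtain n :: nat where n: "a \<le> x" "x \<le> b - 1 / Suc n" by auto
    moreover have "1 / real (Suc n) > 0" by simp
    ultimately show "x \<in> {a..<b}" unfolding atLeastLessThan_iff by linarith
  qed
  then have "(\<lambda>\<omega>. \<exists>x\<in>{a..<b}. F \<omega> x = 0) = (\<lambda>\<omega>. \<exists>n::nat. \<exists>x\<in>{a..b - 1 / Suc n}. F \<omega> x = 0)"
    unfolding fun_eq_iff by blast
  then show ?thesis
    using measurable_pred_ex_root_Icc[OF assms] by (simp add: pred_intros_countable)
qed

lemma measurable_pred_ex_root:
  fixes F :: "'a \<Rightarrow> real \<Rightarrow> real"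
  assumes "\<And>x. (\<lambda>\<omega>. F \<omega> x) \<in> borel_measurable M" "\<And>\<omega>. continuous_on UNIV (F \<omega>)"
  shows "Measurable.pred M (\<lambda>\<omega>. \<exists>x. F \<omega> x = 0)"
proof -
  have "\<exists>n::nat. x \<in> {- real n..real n}" for x :: real
    using real_arch_simple[of "\<bar>x\<bar>"] by (auto simp: abs_le_iff) (metis minus_le_iff)
  then have "(\<lambda>\<omega>. \<exists>x. F \<omega> x = 0) = (\<lambda>\<omega>. \<exists>n::nat. \<exists>x\<in>{- real n..real n}. F \<omega> x = 0)"
    unfolding fun_eq_iff by blast
  then show ?thesis
    using measurable_pred_ex_root_Icc[OF assms] by (simp add: pred_intros_countable)
qed

text \<open>The cells of width 1/K with |i| at most K^2 cover [-K, K], so resolution and range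
  improve together. Eventually every point of A is covered and no two share a cell. This exhibits
  the number of roots as a limit of measurable counts.\<close>

lemma eventually_grid_count_eq_card:
  fixes A :: "real set"
  assumes "finite A"
  shows "\<forall>\<^sub>F K in sequentially.
    (\<Sum>i\<in>{- int (K\<^sup>2)..int (K\<^sup>2)}. of_bool (\<exists>x\<in>A. x \<in> {real_of_int i / real K..<(real_of_int i + 1) / real K}) :: real) = card A"
proof -
  have 1: "\<forall>\<^sub>F K::nat in sequentially. \<forall>x\<in>A. \<forall>y\<in>A. x \<noteq> y \<longrightarrow> \<lfloor>x * K\<rfloor> \<noteq> \<lfloor>y * K\<rfloor>"
  proof (intro eventually_ball_finite assms ballI)
    fix x y :: real
    have "\<forall>\<^sub>F K::nat in sequentially. 1 < real K * \<bar>x - y\<bar>" if "x \<noteq> y"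
      using that by real_asymp
    then have "\<forall>\<^sub>F K::nat in sequentially. x \<noteq> y \<longrightarrow> 1 < real K * \<bar>x - y\<bar>"
      by (cases "x = y") auto
    then show "\<forall>\<^sub>F K::nat in sequentially. x \<noteq> y \<longrightarrow> \<lfloor>x * K\<rfloor> \<noteq> \<lfloor>y * K\<rfloor>"
    proof eventually_elim
      case (elim K)
      show ?case
      proof
        assume "x \<noteq> y"
        with elim have "1 < real K * \<bar>x - y\<bar>" by simp
        also have "\<dots> = \<bar>x * K - y * K\<bar>" by (simp add: abs_mult flip: left_diff_distrib)
        finally show "\<lfloor>x * K\<rfloor> \<noteq> \<lfloor>y * K\<rfloor>" by linarith
      qed
    qed
  qed
  have 2: "\<forall>\<^sub>F K::nat in sequentially. \<forall>x\<in>A. \<bar>x\<bar> * K + 1 \<le> real K ^ 2"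
    by (intro eventually_ball_finite assms ballI) real_asymp
  show ?thesis using 1 2 eventually_gt_at_top[of 0]
  proof eventually_elim
    case (elim K)
    \<comment> \<open>Half-open cells make the index of the cell containing x unique: it is the
      floor of x K.\<close>
    have fl: "x \<in> {real_of_int i / real K..<(real_of_int i + 1) / real K} \<longleftrightarrow> i = \<lfloor>x * K\<rfloor>" for x and i :: int
      using elim(3) by (auto simp: field_simps floor_eq_iff eq_commute[of i])
    have sub: "(\<lambda>x. \<lfloor>x * K\<rfloor>) ` A \<subseteq> {- int (K\<^sup>2)..int (K\<^sup>2)}"
    proof
      fix i assume "i \<in> (\<lambda>x. \<lfloor>x * K\<rfloor>) ` A"
      then obtain x where x: "x \<in> A" "i = \<lfloor>x * K\<rfloor>" by auto
      have "\<bar>x * K\<bar> + 1 \<le> real_of_int (int (K\<^sup>2))" using elim(2) x by (auto simp: abs_mult)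
      then show "i \<in> {- int (K\<^sup>2)..int (K\<^sup>2)}" unfolding x(2) atLeastAtMost_iff by linarith
    qed
    have "(\<Sum>i\<in>{- int (K\<^sup>2)..int (K\<^sup>2)}. of_bool (\<exists>x\<in>A. x \<in> {real_of_int i / real K..<(real_of_int i + 1) / real K}) :: real) =
        (\<Sum>i\<in>{- int (K\<^sup>2)..int (K\<^sup>2)}. of_bool (i \<in> (\<lambda>x. \<lfloor>x * K\<rfloor>) ` A))"
      unfolding fl by (intro sum.cong refl) auto
    also have "\<dots> = card ({- int (K\<^sup>2)..int (K\<^sup>2)} \<inter> (\<lambda>x. \<lfloor>x * K\<rfloor>) ` A)"
      by (subst of_bool_def, subst sum.If_cases) auto
    also have "{- int (K\<^sup>2)..int (K\<^sup>2)} \<inter> (\<lambda>x. \<lfloor>x * K\<rfloor>) ` A = (\<lambda>x. \<lfloor>x * K\<rfloor>) ` A"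
      using sub by auto
    also have "card \<dots> = card A"
      by (rule card_image) (use elim(1) in \<open>auto simp: inj_on_def\<close>)
    finally show ?case .
  qed
qed

lemma measurable_num_real_roots:
  fixes F :: "'a \<Rightarrow> real poly"
  assumes meas: "\<And>x. (\<lambda>\<omega>. poly (F \<omega>) x) \<in> borel_measurable M"
  shows "(\<lambda>\<omega>. real (num_real_roots (F \<omega>))) \<in> borel_measurable M"
proof -
  \<comment> \<open>The zero polynomial needs its own case: its grid counts grow without bound,
    while \<open>num_real_roots\<close> gives 0.\<close>
  define S where "S = (\<lambda>K \<omega>. if F \<omega> = 0 then 0 else
    (\<Sum>i\<in>{- int (K\<^sup>2)..int (K\<^sup>2)}. of_bool (\<exists>x\<in>{real_of_int i / real K..<(real_of_int i + 1) / real K}. poly (F \<omega>) x = 0) :: real))"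
  \<comment> \<open>Vanishing of the polynomial is tested at the naturals, which turns it into a
    countable intersection of measurable conditions.\<close>
  have "F \<omega> = 0 \<longleftrightarrow> (\<forall>k::nat. poly (F \<omega>) (real k) = 0)" for \<omega>
  proof
    assume *: "\<forall>k::nat. poly (F \<omega>) (real k) = 0"
    have "infinite (range (real :: nat \<Rightarrow> real))"
      by (metis finite_imageD infinite_UNIV_nat inj_of_nat)
    moreover have "range real \<subseteq> {x. poly (F \<omega>) x = 0}" using * by auto
    ultimately show "F \<omega> = 0"
      using poly_roots_finite[of "F \<omega>"] finite_subset by blast
  qed auto
  then have [measurable]: "Measurable.pred M (\<lambda>\<omega>. F \<omega> = 0)"
    using meas by simp
  have [measurable]: "Measurable.pred M (\<lambda>\<omega>. \<exists>x\<in>{a..<b}. poly (F \<omega>) x = 0)" for a b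
    by (intro measurable_pred_ex_root_Ico meas continuous_intros)
  show ?thesis
  proof (rule borel_measurable_LIMSEQ_real)
    show "S K \<in> borel_measurable M" for K
      unfolding S_def by measurable
    fix \<omega>
    show "(\<lambda>K. S K \<omega>) \<longlonglongrightarrow> real (num_real_roots (F \<omega>))"
    proof (cases "F \<omega> = 0")
      case True
      then show ?thesis by (simp add: S_def num_real_roots_def infinite_UNIV_char_0)
    next
      case False
      have "\<forall>\<^sub>F K in sequentially. S K \<omega> = real (num_real_roots (F \<omega>))"
        using eventually_grid_count_eq_card[OF poly_roots_finite[OF False]]
        by eventually_elim (use False in \<open>simp add: S_def num_real_roots_def Bex_def conj_commute\<close>)
      then show ?thesis by (rule tendsto_eventually)
    qed
  qed
qed


section \<open>Almost sure simplicity of the roots\<close>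

lemma pderiv_sum: "pderiv (sum f A) = (\<Sum>i\<in>A. pderiv (f i))"
  by (induction A rule: infinite_finite_induct) (auto simp: pderiv_add)

locale iid_gaussian = prob_space M for M :: "'a measure" +
  fixes \<epsilon> :: "nat \<Rightarrow> 'a \<Rightarrow> real"
  assumes indep: "indep_vars (\<lambda>_. borel) \<epsilon> UNIV"
    and gauss: "\<And>k. distributed M lborel (\<epsilon> k) std_normal_density"
begin

lemma measurable_coeff [measurable]: "\<epsilon> k \<in> borel_measurable M"
  using indep by (auto simp: indep_vars_def)

lemma distr_coeff: "distr M borel (\<epsilon> k) = density lborel std_normal_density"
proof -
  have "distr M borel (\<epsilon> k) = distr M lborel (\<epsilon> k)" by (rule distr_cong) auto
  also have "\<dots> = density lborel std_normal_density" by (rule distributed_distr_eq_density[OF gauss])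
  finally show ?thesis .
qed

lemma AE_coeff_notin_finite:
  assumes "finite A"
  shows "AE \<omega> in M. \<epsilon> k \<omega> \<notin> A"
proof -
  have "A \<in> null_sets lborel" using assms by (rule finite_imp_null_set_lborel)
  then have "AE t in lborel. t \<notin> A" by (rule AE_not_in)
  then have "AE t in distr M borel (\<epsilon> k). t \<notin> A"
    unfolding distr_coeff by (subst AE_density) auto
  moreover have "{t \<in> space borel. t \<notin> A} \<in> sets borel"
    using finite_imp_closed[OF assms] by (auto intro!: borel_comp borel_closed simp flip: Compl_eq)
  ultimately show ?thesis by (subst (asm) AE_distr_iff) auto
qed

lemma AE_coeff_nonzero: "AE \<omega> in M. \<epsilon> k \<omega> \<noteq> 0"
  using AE_coeff_notin_finite[of "{0}" k] by simp

text \<open>At a double root, minus the constant term is one of the finitely many critical values of the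
  remaining polynomial, which is independent of the constant term.\<close>

lemma AE_random_poly_simple_roots:
  assumes "d \<ge> 1" "c 0 \<noteq> 0" "c d \<noteq> 0"
  shows "AE \<omega> in M. \<forall>x. poly (random_poly c \<epsilon> d \<omega>) x = 0 \<longrightarrow> poly (pderiv (random_poly c \<epsilon> d \<omega>)) x \<noteq> 0"
proof -
  define I where "I = {1..d}"
  define PY where "PY = PiM I (\<lambda>_. borel :: real measure)"
  define Y where "Y = (\<lambda>\<omega>. restrict (\<lambda>i. \<epsilon> i \<omega>) I)"
  \<comment> \<open>The constant term is packed as a product over a singleton because
    \<open>indep_var_restrict\<close> yields independence of restricted families.\<close>
  define PX where "PX = PiM {0::nat} (\<lambda>_. borel :: real measure)"
  define X where "X = (\<lambda>\<omega>. restrict (\<lambda>i. \<epsilon> i \<omega>) {0})"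
  define q where "q = (\<lambda>y::nat \<Rightarrow> real. \<Sum>k\<in>I. monom (c k * y k) k)"
  \<comment> \<open>A zero of \<open>F p\<close> is a common zero of the polynomial and its
    derivative. Being one continuous function of x, it makes the event of having a double root
    accessible to \<open>measurable_pred_ex_root\<close>.\<close>
  define F where "F = (\<lambda>(p :: (nat \<Rightarrow> real) \<times> (nat \<Rightarrow> real)) x. \<bar>c 0 * snd p 0 + poly (q (fst p)) x\<bar> + \<bar>poly (pderiv (q (fst p))) x\<bar>)"
  have poly_q: "poly (q y) x = (\<Sum>k\<in>I. c k * y k * x ^ k)" for y x
    by (simp add: q_def poly_sum poly_monom)
  have poly_q': "poly (pderiv (q y)) x = (\<Sum>k\<in>I. k * (c k * y k) * x ^ (k - 1))" for y x
    by (simp add: q_def pderiv_sum pderiv_monom poly_sum poly_monom)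
  have "{0..d} = insert 0 I" "0 \<notin> I" by (auto simp: I_def)
  then have split: "random_poly c \<epsilon> d \<omega> = [:c 0 * \<epsilon> 0 \<omega>:] + q (Y \<omega>)" for \<omega>
    by (auto simp: random_poly_def q_def Y_def atMost_atLeast0 monom_0 I_def intro!: sum.cong)
  have comp: "(\<lambda>p. fst p k) \<in> borel_measurable (PY \<Otimes>\<^sub>M PX)" if "k \<in> I" for k
    unfolding PY_def using that by measurable
  have comp0: "(\<lambda>p. snd p 0) \<in> borel_measurable (PY \<Otimes>\<^sub>M PX)"
    unfolding PX_def by measurable
  have F_meas: "(\<lambda>p. F p x) \<in> borel_measurable (PY \<Otimes>\<^sub>M PX)" for x
    unfolding F_def poly_q poly_q' using comp comp0 by measurable
  have F_cont: "continuous_on UNIV (F p)" for p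
    unfolding F_def by (intro continuous_intros)
  have pred: "Measurable.pred (PY \<Otimes>\<^sub>M PX) (\<lambda>p. \<not> (\<exists>x. F p x = 0))"
    by (intro pred_intros_logic measurable_pred_ex_root F_meas F_cont)
  have Y_meas: "Y \<in> measurable M PY" unfolding Y_def PY_def by measurable
  have X_meas: "X \<in> measurable M PX" unfolding X_def PX_def by measurable
  have iv: "indep_var PY Y PX X"
    unfolding PY_def Y_def PX_def X_def by (rule indep_var_restrict[OF indep]) (auto simp: I_def)
  interpret Y: prob_space "distr M PY Y" by (rule prob_space_distr) fact
  interpret X: prob_space "distr M PX X" by (rule prob_space_distr) fact
  interpret YX: pair_sigma_finite "distr M PY Y" "distr M PX X" ..
  have AE_X: "AE t in distr M PX X. t 0 \<notin> A" if "finite A" for A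
  proof (subst AE_distr_iff[OF X_meas])
    have [measurable]: "(\<lambda>t. t 0) \<in> borel_measurable PX"
      unfolding PX_def by (rule measurable_component_singleton) simp
    have [measurable]: "A \<in> sets borel" using that by (intro borel_closed finite_imp_closed)
    show "{t \<in> space PX. t 0 \<notin> A} \<in> sets PX" by measurable
    show "AE \<omega> in M. X \<omega> 0 \<notin> A"
      using AE_coeff_notin_finite[OF that, of 0] by (simp add: X_def)
  qed
  have "AE y in distr M PY Y. y d \<noteq> 0"
  proof (subst AE_distr_iff[OF Y_meas])
    have "(\<lambda>y. y d) \<in> borel_measurable PY"
      unfolding PY_def by (rule measurable_component_singleton) (use assms(1) in \<open>auto simp: I_def\<close>)
    then show "{y \<in> space PY. y d \<noteq> 0} \<in> sets PY" by measurable
    show "AE \<omega> in M. Y \<omega> d \<noteq> 0"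
      using AE_coeff_nonzero[of d] by eventually_elim (use assms(1) in \<open>auto simp: Y_def I_def\<close>)
  qed
  \<comment> \<open>Fubini: with the higher coefficients y frozen and the top one nonzero, the
    derivative is a fixed nonzero polynomial, so only finitely many values of the constant term are
    bad.\<close>
  then have "AE y in distr M PY Y. AE t in distr M PX X. \<not> (\<exists>x. F (y, t) x = 0)"
  proof eventually_elim
    case (elim y)
    have "coeff (pderiv (q y)) (d - 1) = d * (c d * y d)"
      using assms(1) by (simp add: coeff_pderiv q_def coeff_sum I_def)
    with elim assms have "pderiv (q y) \<noteq> 0" by auto
    then have "finite ((\<lambda>x. - poly (q y) x / c 0) ` {x. poly (pderiv (q y)) x = 0})"
      by (intro finite_imageI poly_roots_finite)
    then have "AE t in distr M PX X. t 0 \<notin> (\<lambda>x. - poly (q y) x / c 0) ` {x. poly (pderiv (q y)) x = 0}"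
      by (rule AE_X)
    then show ?case
    proof eventually_elim
      case (elim t)
      show ?case
      proof
        assume "\<exists>x. F (y, t) x = 0"
        then obtain x where "c 0 * t 0 + poly (q y) x = 0" "poly (pderiv (q y)) x = 0"
          unfolding F_def by (auto simp: add_nonneg_eq_0_iff)
        then have "t 0 = - poly (q y) x / c 0" "poly (pderiv (q y)) x = 0"
          using assms(2) by (auto simp: field_simps eq_neg_iff_add_eq_0)
        with elim show False by blast
      qed
    qed
  qed
  then have "AE p in distr M PY Y \<Otimes>\<^sub>M distr M PX X. \<not> (\<exists>x. F p x = 0)"
    using pred by (intro YX.AE_pair_measure) (auto simp: pred_def space_pair_measure cong: sets_pair_measure_cong)
  moreover have "distr M PY Y \<Otimes>\<^sub>M distr M PX X = distr M (PY \<Otimes>\<^sub>M PX) (\<lambda>\<omega>. (Y \<omega>, X \<omega>))"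
    using iv unfolding indep_var_distribution_eq by simp
  ultimately have "AE p in distr M (PY \<Otimes>\<^sub>M PX) (\<lambda>\<omega>. (Y \<omega>, X \<omega>)). \<not> (\<exists>x. F p x = 0)"
    by (simp only:)
  then have "AE \<omega> in M. \<not> (\<exists>x. F (Y \<omega>, X \<omega>) x = 0)"
    using pred Y_meas X_meas by (subst (asm) AE_distr_iff) (auto simp: pred_def)
  then show ?thesis
  proof eventually_elim
    case (elim \<omega>)
    have "F (Y \<omega>, X \<omega>) x = 0"
      if "poly (random_poly c \<epsilon> d \<omega>) x = 0" "poly (pderiv (random_poly c \<epsilon> d \<omega>)) x = 0" for x
      using that by (simp add: split F_def X_def pderiv_add pderiv_pCons)
    with elim show ?case by blast
  qed
qed

end


section \<open>The effect of one block\<close>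

text \<open>The value 0 at the zero polynomial makes this hold without exception. It supplies
  integrability and the dominating constants.\<close>

lemma num_real_roots_le_degree: "num_real_roots p \<le> degree p"
proof (cases "p = 0")
  case True
  then show ?thesis by (simp add: num_real_roots_def infinite_UNIV_char_0)
next
  case False
  then show ?thesis unfolding num_real_roots_def by (rule card_poly_roots_bound)
qed

lemma degree_random_poly_le: "degree (random_poly c \<epsilon> n \<omega>) \<le> n"
  unfolding random_poly_def by (intro degree_sum_le) (auto intro: order.trans[OF degree_monom_le])

lemma coeff_random_poly: "coeff (random_poly c \<epsilon> n \<omega>) k = (if k \<le> n then c k * \<epsilon> k \<omega> else 0)"
  by (simp add: random_poly_def coeff_sum)

lemma random_poly_cong:
  "(\<And>k. k \<le> n \<Longrightarrow> c k = c' k) \<Longrightarrow> random_poly c \<epsilon> n = random_poly c' \<epsilon> n"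
  by (simp add: random_poly_def fun_eq_iff)

context iid_gaussian
begin

definition expected_real_roots :: "(nat \<Rightarrow> real) \<Rightarrow> nat \<Rightarrow> real" where
  "expected_real_roots c n = (\<integral>\<omega>. real (num_real_roots (random_poly c \<epsilon> n \<omega>)) \<partial>M)"

lemma expected_real_roots_cong:
  "(\<And>k. k \<le> n \<Longrightarrow> c k = c' k) \<Longrightarrow> expected_real_roots c n = expected_real_roots c' n"
  unfolding expected_real_roots_def by (subst random_poly_cong[of n c c']) auto

lemma expected_real_roots_0: "expected_real_roots c 0 = 0"
proof -
  have "num_real_roots (random_poly c \<epsilon> 0 \<omega>) = 0" for \<omega>
    using num_real_roots_le_degree[of "random_poly c \<epsilon> 0 \<omega>"] degree_random_poly_le[of c \<epsilon> 0 \<omega>] by simp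
  then show ?thesis by (simp add: expected_real_roots_def)
qed

lemma measurable_num_real_roots_random_poly [measurable]:
  "(\<lambda>\<omega>. real (num_real_roots (random_poly c \<epsilon> n \<omega>))) \<in> borel_measurable M"
  by (intro measurable_num_real_roots) (simp add: random_poly_def poly_sum poly_monom)

lemma integrable_num_real_roots: "integrable M (\<lambda>\<omega>. real (num_real_roots (random_poly c \<epsilon> n \<omega>)))"
proof (rule integrable_const_bound[of _ n])
  show "AE \<omega> in M. norm (real (num_real_roots (random_poly c \<epsilon> n \<omega>))) \<le> real n"
    using num_real_roots_le_degree degree_random_poly_le[of c \<epsilon> n]
    by (auto intro: order.trans)
qed simp

text \<open>The value is 1/4; the product form is what independence delivers directly.\<close>

definition sign_change_prob :: real where
  "sign_change_prob = measure (density lborel std_normal_density) {0<..} * measure (density lborel std_normal_density) {..<0}"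

lemma prob_sign_change:
  assumes "i \<noteq> j"
  shows "prob {\<omega> \<in> space M. \<epsilon> i \<omega> > 0 \<and> \<epsilon> j \<omega> < 0} = sign_change_prob"
proof -
  have prob_eq: "prob (\<epsilon> k -` B \<inter> space M) = measure (density lborel std_normal_density) B"
    if "B \<in> sets borel" for k B
    using that by (simp add: measure_distr flip: distr_coeff[of k])
  let ?A = "\<lambda>k. if k = i then {0<..} else {..<0::real}"
  have "prob (\<Inter>k\<in>{i, j}. \<epsilon> k -` ?A k \<inter> space M) = (\<Prod>k\<in>{i, j}. prob (\<epsilon> k -` ?A k \<inter> space M))"
    by (rule indep_varsD[OF indep]) auto
  also have "(\<Inter>k\<in>{i, j}. \<epsilon> k -` ?A k \<inter> space M) = {\<omega> \<in> space M. \<epsilon> i \<omega> > 0 \<and> \<epsilon> j \<omega> < 0}"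
    using assms by auto
  also have "(\<Prod>k\<in>{i, j}. prob (\<epsilon> k -` ?A k \<inter> space M)) = sign_change_prob"
    using assms by (simp add: sign_change_prob_def prob_eq)
  finally show ?thesis .
qed

text \<open>A nonempty open set has positive Lebesgue measure, and the Gaussian density is positive
  everywhere.\<close>

lemma sign_change_prob_pos: "sign_change_prob > 0"
proof -
  interpret N: prob_space "density lborel std_normal_density"
    by (rule prob_space_normal_density) simp
  have "measure (density lborel std_normal_density) A > 0" if A: "open A" "A \<noteq> {}" for A :: "real set"
  proof -
    have "A \<notin> null_sets lborel" using A open_not_negligible negligible_iff_null_sets
        null_sets_completionI by blast
    have "A \<notin> null_sets (density lborel std_normal_density)"
    proof
      assume "A \<in> null_sets (density lborel std_normal_density)"
      then have "AE x in lborel. x \<in> A \<longrightarrow> ennreal (std_normal_density x) = 0"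
        by (subst (asm) null_sets_density_iff) auto
      then have "AE x in lborel. x \<notin> A"
        by eventually_elim (metis ennreal_eq_0_iff normal_density_pos not_le zero_less_one)
      then have "A \<in> null_sets lborel" using A by (subst AE_iff_null_sets) auto
      with \<open>A \<notin> null_sets lborel\<close> show False ..
    qed
    then show ?thesis using A by (auto simp: N.emeasure_eq_measure zero_less_measure_iff null_sets_def)
  qed
  then show ?thesis unfolding sign_change_prob_def by (intro mult_pos_pos) auto
qed

text \<open>Almost surely the new count lies between R + 1_W and R + 2 for all large i, where R
  counts the roots of the old part and W is the sign-change event. The threshold for i depends on
  the sample point, so the expectations need some slack: 3 instead of 2 above, and half of the
  probability of W below.\<close>

lemma eventually_expected_real_roots_extend:
  assumes m: "m \<ge> 1" "m \<le> n" and c: "\<And>k. k < m \<Longrightarrow> c k > 0"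
  shows "\<forall>\<^sub>F i in sequentially.
    expected_real_roots c (m - 1) + sign_change_prob / 2 \<le> expected_real_roots (\<lambda>k. if k < m then c k else 1 / Suc i) n \<and>
    expected_real_roots (\<lambda>k. if k < m then c k else 1 / Suc i) n \<le> expected_real_roots c (m - 1) + 3"
proof -
  define cc where "cc = (\<lambda>i k. if k < m then c k else 1 / real (Suc i))"
  define g where "g = random_poly c \<epsilon> (m - 1)"
  define h where "h = random_poly (\<lambda>k. if k < m then 0 else 1) \<epsilon> n"
  define f where "f = (\<lambda>i. random_poly (cc i) \<epsilon> n)"
  have f_eq: "f i \<omega> = g \<omega> + smult (1 / Suc i) (h \<omega>)" for i \<omega>
    unfolding f_def g_def h_def cc_def using m
    by (intro poly_eqI) (auto simp: coeff_random_poly)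
  define R where "R = (\<lambda>\<omega>. real (num_real_roots (g \<omega>)))"
  define Rf where "Rf = (\<lambda>i \<omega>. real (num_real_roots (f i \<omega>)))"
  define W where "W = {\<omega> \<in> space M. \<epsilon> (m - 1) \<omega> > 0 \<and> \<epsilon> n \<omega> < 0}"
  have [measurable]: "W \<in> events" unfolding W_def by measurable
  have [measurable]: "R \<in> borel_measurable M" "Rf i \<in> borel_measurable M" for i
    unfolding R_def Rf_def g_def f_def by auto
  have int: "integrable M R" "integrable M (Rf i)" for i
    unfolding R_def Rf_def g_def f_def by (auto intro: integrable_num_real_roots)
  have R_le: "R \<omega> \<le> m" and Rf_le: "Rf i \<omega> \<le> n" for i \<omega>
    using num_real_roots_le_degree[of "g \<omega>"] degree_random_poly_le[of c \<epsilon> "m - 1" \<omega>]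
      num_real_roots_le_degree[of "f i \<omega>"] degree_random_poly_le[of "cc i" \<epsilon> n \<omega>]
    by (auto simp: R_def Rf_def g_def f_def)
  have nonneg: "R \<omega> \<ge> 0" "Rf i \<omega> \<ge> 0" for i \<omega> by (auto simp: R_def Rf_def)
  \<comment> \<open>\<open>u\<close> and \<open>l\<close> measure by how much the upper and the
    lower pointwise bound fail. Both are bounded and eventually 0 almost surely, so their integrals
    tend to 0.\<close>
  define u where "u = (\<lambda>i \<omega>. max 0 (Rf i \<omega> - R \<omega> - 2))"
  define l where "l = (\<lambda>i \<omega>. max 0 (R \<omega> + indicator W \<omega> - Rf i \<omega>))"
  have simple: "AE \<omega> in M. \<forall>x. poly (g \<omega>) x = 0 \<longrightarrow> poly (pderiv (g \<omega>)) x \<noteq> 0"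
  \<comment> \<open>For m = 1 the old part is a nonzero constant without roots; the lemma on simple
    roots asks for degree at least 1.\<close>
  proof (cases "m = 1")
    case True
    show ?thesis using AE_coeff_nonzero[of 0]
    proof eventually_elim
      case (elim \<omega>)
      then show ?case using c[of 0] True
        by (simp add: g_def random_poly_def monom_0)
    qed
  next
    case False
    have "c 0 \<noteq> 0" "c (m - 1) \<noteq> 0" using c[of 0] c[of "m - 1"] m by auto
    then show ?thesis unfolding g_def using False m by (intro AE_random_poly_simple_roots) auto
  qed
  have ev: "AE \<omega> in M. \<forall>\<^sub>F i in sequentially. u i \<omega> = 0 \<and> l i \<omega> = 0"
    using AE_coeff_nonzero[of "m - 1"] AE_coeff_nonzero[of n] simple AE_space
  proof eventually_elim
    case (elim \<omega>)
    have cm: "c (m - 1) > 0" using c[of "m - 1"] m by auto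
    have "coeff (g \<omega>) (m - 1) \<noteq> 0" using elim cm by (simp add: g_def coeff_random_poly)
    then have dg: "degree (g \<omega>) = m - 1" and g0: "g \<omega> \<noteq> 0"
      using degree_random_poly_le[of c \<epsilon> "m - 1" \<omega>] le_degree[of "g \<omega>" "m - 1"]
      by (auto simp: g_def)
    have "coeff (h \<omega>) n \<noteq> 0" using elim m by (simp add: h_def coeff_random_poly)
    then have dh: "degree (h \<omega>) = n"
      using degree_random_poly_le[of "\<lambda>k. if k < m then 0 else 1" \<epsilon> n \<omega>] le_degree[of "h \<omega>" n]
      by (auto simp: h_def)
    have lc: "lead_coeff (g \<omega>) = c (m - 1) * \<epsilon> (m - 1) \<omega>" "lead_coeff (h \<omega>) = \<epsilon> n \<omega>"
      using m unfolding dg dh by (auto simp: g_def h_def coeff_random_poly)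
    have lim: "filterlim (\<lambda>i::nat. 1 / real (Suc i)) (at_right 0) sequentially"
      by real_asymp
    have deg: "degree (g \<omega>) < degree (h \<omega>)" using dg dh m by simp
    have roots: "\<And>x. poly (g \<omega>) x = 0 \<Longrightarrow> poly (pderiv (g \<omega>)) x \<noteq> 0" using elim by blast
    have "\<forall>\<^sub>F i in sequentially. num_real_roots (f i \<omega>) \<le> num_real_roots (g \<omega>) + 2"
      unfolding f_eq
      by (rule eventually_compose_filterlim[OF eventually_num_real_roots_perturbed_le[OF g0 deg roots] lim])
    moreover have "\<forall>\<^sub>F i in sequentially. num_real_roots (g \<omega>) +
         (if lead_coeff (g \<omega>) > 0 \<and> lead_coeff (h \<omega>) < 0 then 1 else 0) \<le> num_real_roots (f i \<omega>)"
      unfolding f_eq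
      by (rule eventually_compose_filterlim[OF eventually_num_real_roots_perturbed_ge[OF g0 deg roots] lim])
    ultimately show ?case
    proof eventually_elim
      case (elim i)
      have "indicator W \<omega> = (if lead_coeff (g \<omega>) > 0 \<and> lead_coeff (h \<omega>) < 0 then 1 else 0 :: real)"
        using cm \<open>\<omega> \<in> space M\<close> unfolding lc by (auto simp: W_def indicator_def zero_less_mult_iff)
      with elim show ?case by (auto simp: u_def l_def Rf_def R_def split: if_splits)
    qed
  qed
  have lim_u: "(\<lambda>i. \<integral>\<omega>. u i \<omega> \<partial>M) \<longlonglongrightarrow> (\<integral>\<omega>. 0 \<partial>M)"
  proof (rule integral_dominated_convergence[where w = "\<lambda>_. real n"])
    show "AE \<omega> in M. (\<lambda>i. u i \<omega>) \<longlonglongrightarrow> 0"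
      using ev by eventually_elim (auto intro: tendsto_eventually elim: eventually_mono)
    show "AE \<omega> in M. norm (u i \<omega>) \<le> real n" for i
    proof (intro AE_I2)
      fix \<omega>
      have "Rf i \<omega> - R \<omega> - 2 \<le> real n"
        using Rf_le[of i \<omega>] nonneg(1)[of \<omega>] by linarith
      then show "norm (u i \<omega>) \<le> real n" by (simp add: u_def)
    qed
  qed (auto simp: u_def)
  have lim_l: "(\<lambda>i. \<integral>\<omega>. l i \<omega> \<partial>M) \<longlonglongrightarrow> (\<integral>\<omega>. 0 \<partial>M)"
  proof (rule integral_dominated_convergence[where w = "\<lambda>_. real m + 1"])
    show "AE \<omega> in M. (\<lambda>i. l i \<omega>) \<longlonglongrightarrow> 0"
      using ev by eventually_elim (auto intro: tendsto_eventually elim: eventually_mono)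
    show "AE \<omega> in M. norm (l i \<omega>) \<le> real m + 1" for i
    proof (intro AE_I2)
      fix \<omega>
      have "R \<omega> + indicator W \<omega> - Rf i \<omega> \<le> real m + 1"
        using R_le[of \<omega>] nonneg(2)[of i \<omega>] by (auto simp: indicator_def)
      then show "norm (l i \<omega>) \<le> real m + 1" by (simp add: l_def)
    qed
  qed (auto simp: l_def)
  have int_W: "integrable M (indicator W :: 'a \<Rightarrow> real)"
    by (rule integrable_const_bound[of _ 1]) auto
  have int_u: "integrable M (u i)" and int_l: "integrable M (l i)" for i
    unfolding u_def l_def using int int_W
    by (intro integrable_max Bochner_Integration.integrable_diff Bochner_Integration.integrable_add; simp)+
  have PW: "prob W = sign_change_prob"
    unfolding W_def by (rule prob_sign_change) (use m in auto)
  have "\<forall>\<^sub>F i in sequentially. (\<integral>\<omega>. u i \<omega> \<partial>M) < 1"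
    by (rule order_tendstoD(2)[OF lim_u]) simp
  moreover have "\<forall>\<^sub>F i in sequentially. (\<integral>\<omega>. l i \<omega> \<partial>M) < sign_change_prob / 2"
    by (rule order_tendstoD(2)[OF lim_l]) (use sign_change_prob_pos in simp)
  ultimately show ?thesis
  proof eventually_elim
    case (elim i)
    have "(\<integral>\<omega>. Rf i \<omega> \<partial>M) \<le> (\<integral>\<omega>. R \<omega> + 2 + u i \<omega> \<partial>M)"
      using int int_u by (intro integral_mono) (auto simp: u_def)
    also have "\<dots> = (\<integral>\<omega>. R \<omega> \<partial>M) + 2 + (\<integral>\<omega>. u i \<omega> \<partial>M)"
      using int int_u by (simp add: prob_space)
    finally have 1: "(\<integral>\<omega>. Rf i \<omega> \<partial>M) \<le> (\<integral>\<omega>. R \<omega> \<partial>M) + 3" using elim by simp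
    have "(\<integral>\<omega>. R \<omega> + indicator W \<omega> - l i \<omega> \<partial>M) \<le> (\<integral>\<omega>. Rf i \<omega> \<partial>M)"
      using int int_l int_W by (intro integral_mono) (auto simp: l_def)
    also have "(\<integral>\<omega>. R \<omega> + indicator W \<omega> - l i \<omega> \<partial>M) = (\<integral>\<omega>. R \<omega> \<partial>M) + prob W - (\<integral>\<omega>. l i \<omega> \<partial>M)"
      using int int_l int_W by simp
    finally have 2: "(\<integral>\<omega>. R \<omega> \<partial>M) + sign_change_prob / 2 \<le> (\<integral>\<omega>. Rf i \<omega> \<partial>M)"
      using elim PW by simp
    show ?case using 1 2
      by (simp add: expected_real_roots_def R_def Rf_def f_def g_def cc_def)
  qed
qed

end


section \<open>Choice of the blocks\<close>

text \<open>Taking logarithms determines the correction to the exponent, and constant factors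
  contribute only O(1 / ln n) to it. The term -1 allows for rounding n powr alpha down to a block
  index.\<close>

lemma power_asympI:
  assumes "\<alpha> > 0" "K > 0" "K' > 0"
    and bounds: "\<forall>\<^sub>F n in sequentially. K * (real n powr \<alpha> - 1) \<le> a n \<and> a n \<le> K' * real n powr \<alpha>"
  shows "power_asymp a \<alpha>"
  unfolding power_asymp_def
proof (intro exI conjI)
  define \<delta> where "\<delta> = (\<lambda>n. ln (a n) / ln (real n) - \<alpha>)"
  have gt1: "\<forall>\<^sub>F n in sequentially. real n powr \<alpha> > 1"
    using assms(1) by real_asymp
  show "\<forall>\<^sub>F n in sequentially. a n = real n powr (\<alpha> + \<delta> n)"
    using bounds gt1 eventually_gt_at_top[of 1]
  proof eventually_elim
    case (elim n)
    have "0 < K * (real n powr \<alpha> - 1)" using elim assms by auto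
    then have "a n > 0" using elim by linarith
    then show ?case using elim by (simp add: \<delta>_def powr_def)
  qed
  show "\<delta> \<longlonglongrightarrow> 0"
  proof (rule tendsto_sandwich)
    show "(\<lambda>n. ln (K * (real n powr \<alpha> - 1)) / ln (real n) - \<alpha>) \<longlonglongrightarrow> 0"
      using assms by real_asymp
    show "(\<lambda>n. ln (K' * real n powr \<alpha>) / ln (real n) - \<alpha>) \<longlonglongrightarrow> 0"
      using assms by real_asymp
    show "\<forall>\<^sub>F n in sequentially. ln (K * (real n powr \<alpha> - 1)) / ln (real n) - \<alpha> \<le> \<delta> n"
      using bounds gt1 eventually_gt_at_top[of 1]
    proof eventually_elim
      case (elim n)
      have "0 < K * (real n powr \<alpha> - 1)" using elim assms by auto
      then show ?case using elim by (auto simp: \<delta>_def intro!: divide_right_mono)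
    qed
    show "\<forall>\<^sub>F n in sequentially. \<delta> n \<le> ln (K' * real n powr \<alpha>) / ln (real n) - \<alpha>"
      using bounds gt1 eventually_gt_at_top[of 1]
    proof eventually_elim
      case (elim n)
      have "0 < K * (real n powr \<alpha> - 1)" using elim assms by auto
      then show ?case using elim by (auto simp: \<delta>_def intro!: divide_right_mono)
    qed
  qed
qed

text \<open>As p = 1/alpha exceeds 1, consecutive p-th powers differ by at least 1, so their
  ceilings are distinct. Raising to the power alpha recovers the block index from n.\<close>

lemma block_starts:
  fixes \<alpha> :: real and m :: "nat \<Rightarrow> nat"
  assumes "0 < \<alpha>" "\<alpha> < 1" and m_def: "\<And>j. m j = nat \<lceil>real j powr (1 / \<alpha>)\<rceil>"
  shows "strict_mono m" "m 0 = 0" "m 1 = 1"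
    "\<And>j n. m j \<le> n \<Longrightarrow> n < m (Suc j) \<Longrightarrow> real j \<le> real n powr \<alpha> \<and> real n powr \<alpha> < real j + 1"
proof -
  define p where "p = 1 / \<alpha>"
  have p: "p > 1" "p * \<alpha> = 1" using assms by (auto simp: p_def)
  have m_def': "m j = nat \<lceil>real j powr p\<rceil>" for j by (simp add: m_def p_def)
  show "m 0 = 0" "m 1 = 1" by (auto simp: m_def')
  have "real j powr p + 1 \<le> real (Suc j) powr p" for j
  proof (cases "j = 0")
    case False
    \<comment> \<open>The estimate is j^p + 1 <= (j + 1) j^(p-1) <= (j + 1)^p, using j^(p-1) >=
      1.\<close>
    have "real j powr p + 1 \<le> real j * real j powr (p - 1) + real j powr (p - 1)"
    proof (rule add_mono)
      show "real j powr p \<le> real j * real j powr (p - 1)" using False by (simp add: powr_diff)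
      show "1 \<le> real j powr (p - 1)" using False p by (intro ge_one_powr_ge_zero) auto
    qed
    also have "\<dots> = real (Suc j) * real j powr (p - 1)" by (simp add: algebra_simps)
    also have "\<dots> \<le> real (Suc j) * real (Suc j) powr (p - 1)"
      using p by (intro mult_left_mono powr_mono2) auto
    also have "\<dots> = real (Suc j) powr p" by (simp add: powr_diff)
    finally show ?thesis .
  qed auto
  then have "\<lceil>real j powr p\<rceil> < \<lceil>real (Suc j) powr p\<rceil>" for j
    by (smt (verit) ceiling_add_one ceiling_mono)
  moreover have "0 \<le> \<lceil>real j powr p\<rceil>" for j
    by (smt (verit) ceiling_le_zero powr_ge_zero zero_le_ceiling)
  ultimately have "m j < m (Suc j)" for j
    unfolding m_def' by (subst zless_nat_conj) (smt (verit))
  then show "strict_mono m" by (rule strict_monoI_Suc)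
  show "real j \<le> real n powr \<alpha> \<and> real n powr \<alpha> < real j + 1" if "m j \<le> n" "n < m (Suc j)" for j n
  proof
    have root: "(real i powr p) powr \<alpha> = real i" for i :: nat
      using p by (simp add: powr_powr)
    \<comment> \<open>For an integer n, comparison with a ceiling amounts to comparison with the
      number itself, so rounding loses nothing in either bound.\<close>
    have "real j powr p \<le> real n" using that(1) by (simp add: m_def' nat_le_iff ceiling_le_iff)
    then have "(real j powr p) powr \<alpha> \<le> real n powr \<alpha>" using assms by (intro powr_mono2) auto
    then show "real j \<le> real n powr \<alpha>" by (simp only: root)
    have "int n < \<lceil>real (Suc j) powr p\<rceil>" using that(2) by (simp add: m_def' zless_nat_eq_int_zless)
    then have "real n < real (Suc j) powr p" by (simp add: less_ceiling_iff)
    then have "real n powr \<alpha> < (real (Suc j) powr p) powr \<alpha>" using assms by (intro powr_less_mono2) auto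
    then show "real n powr \<alpha> < real j + 1" by (simp only: root)
  qed
qed


section \<open>The coefficients\<close>

context iid_gaussian
begin

text \<open>Dependent choice produces full sequences \<open>s j\<close>: stage j + 1 keeps the
  entries below \<open>m (Suc j)\<close> and replaces the tail by a smaller constant. Every entry is
  eventually frozen, and the diagonal sequence inherits the root estimates, as these involve only
  finitely many coefficients.\<close>

lemma exists_decseq_block_coeffs:
  fixes m :: "nat \<Rightarrow> nat"
  assumes m: "strict_mono m" "m 0 = 0" "m 1 = 1"
  obtains c where "decseq c" "Bseq c"
    "\<And>j n. m j \<le> n \<Longrightarrow> n < m (Suc j) \<Longrightarrow>
       sign_change_prob / 2 * j \<le> expected_real_roots c n \<and> expected_real_roots c n \<le> 3 * real j"
proof -
  let ?K = "sign_change_prob / 2"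
  define P where "P = (\<lambda>(j :: nat) (c :: nat \<Rightarrow> real). (\<forall>k. 0 < c k) \<and> decseq c)"
  define Q where "Q = (\<lambda>(j :: nat) c c'. (\<forall>k<m (Suc j). c' k = c k) \<and>
    (\<forall>n\<in>{m (Suc j)..<m (Suc (Suc j))}.
       expected_real_roots c (m (Suc j) - 1) + ?K \<le> expected_real_roots c' n \<and>
       expected_real_roots c' n \<le> expected_real_roots c (m (Suc j) - 1) + 3))"
  have m_ge: "j \<le> m j" for j by (rule strict_mono_imp_increasing[OF m(1)])
  have "\<exists>s. \<forall>j. P j (s j) \<and> Q j (s j) (s (Suc j))"
  proof (rule dependent_nat_choice)
    show "\<exists>c. P 0 c" by (intro exI[of _ "\<lambda>_. 1"]) (auto simp: P_def decseq_def)
  next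
    fix c j assume "P j c"
    then have c: "\<And>k. 0 < c k" "decseq c" by (auto simp: P_def)
    define b where "b = m (Suc j)"
    define c' where "c' = (\<lambda>(i::nat) k. if k < b then c k else 1 / real (Suc i))"
    have b: "b \<ge> 1" using m_ge[of "Suc j"] by (simp add: b_def)
    have "\<forall>\<^sub>F i in sequentially. \<forall>n\<in>{b..<m (Suc (Suc j))}.
       expected_real_roots c (b - 1) + ?K \<le> expected_real_roots (c' i) n \<and>
       expected_real_roots (c' i) n \<le> expected_real_roots c (b - 1) + 3"
      unfolding c'_def
      by (intro eventually_ball_finite ballI eventually_expected_real_roots_extend) (use b c in auto)
    \<comment> \<open>Since c decreases, lying below \<open>c b\<close> puts the new constant below
      all retained entries, which keeps the sequence decreasing.\<close>
    moreover have "\<forall>\<^sub>F i::nat in sequentially. 1 / real (Suc i) < c b"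
      by (rule order_tendstoD(2)[of _ 0]) (real_asymp, rule c)
    ultimately have "\<forall>\<^sub>F i in sequentially. P (Suc j) (c' i) \<and> Q j c (c' i)"
    proof eventually_elim
      case (elim i)
      have "c' i (Suc k) \<le> c' i k" for k
      proof -
        have "1 / real (Suc i) \<le> c k" if "k < b"
          using elim(2) decseqD[OF c(2), of k b] that by simp
        then show ?thesis using decseqD[OF c(2), of k "Suc k"] by (auto simp: c'_def)
      qed
      then have "P (Suc j) (c' i)" using c by (auto simp: P_def c'_def decseq_Suc_iff)
      moreover have "Q j c (c' i)" using elim(1) by (auto simp: Q_def b_def c'_def)
      ultimately show ?case ..
    qed
    then show "\<exists>c'. P (Suc j) c' \<and> Q j c c'"
      using eventually_happens'[OF sequentially_bot] by blast
  qed
  then obtain s where s: "\<And>j. P j (s j)" "\<And>j. Q j (s j) (s (Suc j))" by blast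
  have s_eq: "s i k = s j k" if "k < m (Suc j)" "j \<le> i" for i j k
    using that(2)
  proof (induction i rule: dec_induct)
    case (step i)
    have "m (Suc j) \<le> m (Suc i)" using step by (simp add: strict_mono_less_eq[OF m(1)])
    then have "s (Suc i) k = s i k" using s(2)[of i] that(1) by (auto simp: Q_def)
    then show ?case using step by simp
  qed simp
  \<comment> \<open>The diagonal is safe because k < \<open>m (Suc k)\<close>, so entry k no longer
    changes after stage k.\<close>
  define c where "c = (\<lambda>k. s k k)"
  have less: "k < m (Suc k)" for k using m_ge[of "Suc k"] by simp
  have c_eq: "c k = s j k" if "k < m (Suc j)" for j k
    using s_eq[of k k "max j k"] s_eq[of k j "max j k"] less[of k] that by (simp add: c_def)
  have "c (Suc k) \<le> c k" for k
    using c_eq[of k "Suc k"] less[of "Suc k"] s(1)[of "Suc k"]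
    by (auto simp: P_def decseq_Suc_iff c_def)
  then have dec: "decseq c" by (simp add: decseq_Suc_iff)
  have pos: "c k > 0" for k using s(1) by (auto simp: P_def c_def)
  have bseq: "Bseq c"
  proof (rule BseqI'[of _ "c 0"])
    show "norm (c k) \<le> c 0" for k using decseqD[OF dec, of 0 k] pos[of k] by simp
  qed
  have e_eq: "expected_real_roots c n = expected_real_roots (s j) n" if "n < m (Suc j)" for n j
    by (rule expected_real_roots_cong) (use c_eq that in auto)
  have "?K * j \<le> expected_real_roots c n \<and> expected_real_roots c n \<le> 3 * real j"
    if "m j \<le> n" "n < m (Suc j)" for j n
    using that
  proof (induction j arbitrary: n)
    case 0
    \<comment> \<open>Block 0 consists of n = 0 alone, where the polynomial is constant and the
      count is 0.\<close>
    then have "n = 0" using m by simp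
    then show ?case by (simp add: expected_real_roots_0)
  next
    case (Suc j)
    \<comment> \<open>The last index of the previous block: the old part of every polynomial in the
      new block is the random polynomial with this index, so the induction hypothesis is applied
      there.\<close>
    let ?n = "m (Suc j) - 1"
    have lt: "m j < m (Suc j)" by (rule strict_monoD[OF m(1)]) simp
    then have IH: "?K * j \<le> expected_real_roots c ?n \<and> expected_real_roots c ?n \<le> 3 * real j"
      by (intro Suc.IH) auto
    have "expected_real_roots (s j) ?n + ?K \<le> expected_real_roots (s (Suc j)) n \<and>
       expected_real_roots (s (Suc j)) n \<le> expected_real_roots (s j) ?n + 3"
      using s(2)[of j] Suc.prems by (auto simp: Q_def)
    moreover have "expected_real_roots (s j) ?n = expected_real_roots c ?n"
      by (rule e_eq[symmetric]) (use lt in auto)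
    moreover have "expected_real_roots (s (Suc j)) n = expected_real_roots c n"
      by (rule e_eq[symmetric]) (use Suc.prems in auto)
    ultimately show ?case using IH by (auto simp: algebra_simps)
  qed
  then show thesis using that dec bseq by blast
qed

end

theorem theorem1p2:
  fixes M :: "'a measure" and \<epsilon> :: "nat \<Rightarrow> 'a \<Rightarrow> real"
  assumes "prob_space M"
    and "prob_space.indep_vars M (\<lambda>_. borel) \<epsilon> UNIV"
    and "\<And>k. distributed M lborel (\<epsilon> k) std_normal_density"
  shows "\<forall>\<alpha>\<in>{0<..<1}. \<exists>c :: nat \<Rightarrow> real. monoseq c \<and> Bseq c \<and>
           power_asymp (\<lambda>n. \<integral>\<omega>. real (num_real_roots (random_poly c \<epsilon> n \<omega>)) \<partial>M) \<alpha>"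
proof
  fix \<alpha> :: real assume "\<alpha> \<in> {0<..<1}"
  then have \<alpha>: "0 < \<alpha>" "\<alpha> < 1" by auto
  interpret prob_space M by fact
  interpret iid_gaussian M \<epsilon> by unfold_locales fact+
  define m where "m = (\<lambda>j::nat. nat \<lceil>real j powr (1 / \<alpha>)\<rceil>)"
  note m = block_starts[OF \<alpha> fun_cong[OF m_def]]
  obtain c where c: "decseq c" "Bseq c"
    "\<And>j n. m j \<le> n \<Longrightarrow> n < m (Suc j) \<Longrightarrow>
       sign_change_prob / 2 * j \<le> expected_real_roots c n \<and> expected_real_roots c n \<le> 3 * real j"
    using exists_decseq_block_coeffs[OF m(1-3)] by blast
  have "power_asymp (expected_real_roots c) \<alpha>"
  proof (rule power_asympI[OF \<alpha>(1)])
    show "sign_change_prob / 2 > 0" "(3::real) > 0" using sign_change_prob_pos by auto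
    show "\<forall>\<^sub>F n in sequentially. sign_change_prob / 2 * (real n powr \<alpha> - 1) \<le> expected_real_roots c n \<and>
            expected_real_roots c n \<le> 3 * real n powr \<alpha>"
    proof (intro always_eventually allI)
      fix n
      obtain j where j: "m j \<le> n" "n < m (Suc j)"
      proof -
        define j where "j = (LEAST j. n < m (Suc j))"
        have "n < m (Suc n)" using strict_mono_imp_increasing[OF m(1), of "Suc n"] by simp
        then have "n < m (Suc j)" unfolding j_def by (rule LeastI)
        moreover have "m j \<le> n"
        proof (cases j)
          case (Suc i)
          then show ?thesis using not_less_Least[of i "\<lambda>j. n < m (Suc j)"] by (simp add: j_def)
        qed (simp add: m)
        ultimately show thesis using that by blast
      qed
      \<comment> \<open>Here j > n powr alpha - 1; the upper bound uses j <= n powr alpha.\<close>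
      have "sign_change_prob / 2 * (real n powr \<alpha> - 1) \<le> sign_change_prob / 2 * j"
        using m(4)[OF j] sign_change_prob_pos by (intro mult_left_mono) auto
      then show "sign_change_prob / 2 * (real n powr \<alpha> - 1) \<le> expected_real_roots c n \<and>
            expected_real_roots c n \<le> 3 * real n powr \<alpha>"
        using c(3)[OF j] m(4)[OF j] by linarith
    qed
  qed
  then show "\<exists>c :: nat \<Rightarrow> real. monoseq c \<and> Bseq c \<and>
           power_asymp (\<lambda>n. \<integral>\<omega>. real (num_real_roots (random_poly c \<epsilon> n \<omega>)) \<partial>M) \<alpha>"
    using c(1,2) unfolding expected_real_roots_def[abs_def]
    by (intro exI[of _ c]) (auto simp: monoseq_iff)
qed

end
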